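(* Let $b>0$ and let $f$ be a real-valued non-vanishing continuous function on $[-b,b]$. Then the system of functions $\{\varphi_k\}_{k=0}^{\infty}$ constructed from $f$ is a Markov system, i.e., for any $n\in\mathbb{N}_0$ the first $n+1$ functions $\varphi_0,\ldots,\varphi_n$ form a Tchebyshev system and the subspace $\Phi_n$ spanned by these functions satisfies the Haar condition.
   Context: Functions $\varphi_k$: fix a point $x_0\in[-b,b]$. Let $\widetilde X^{(0)}\equiv X^{(0)}\equiv1$ and, for $n\ge1$, $\widetilde X^{(n)}(x)=n\int_{x_0}^x\widetilde X^{(n-1)}(s)(f^2(s))^{(-1)^{n-1}}ds$, $X^{(n)}(x)=n\int_{x_0}^xX^{(n-1)}(s)(f^2(s))^{(-1)^{n}}ds$; set $\varphi_k=fX^{(k)}$ for $k$ odd and $\varphi_k=f\widetilde X^{(k)}$ for $k$ even. A linear subspace $V\subset C[-b,b]$ of finite dimension $n+1$ satisfies the Haar condition if every function in $V$ which is not identically zero vanishes at no more than $n$ points of $[-b,b]$. A system of linearly independent functions $h_0,\ldots,h_n$ is called a Tchebyshev system if the linear subspace spanned by these functions satisfies the Haar condition. $\mathbb{N}_0$ denotes the non-negative integers. *)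

theory Defs
  imports "HOL-Analysis.Analysis" "HOL-Library.Function_Algebras"
begin

definition fun_scale :: "real \<Rightarrow> (real \<Rightarrow> real) \<Rightarrow> real \<Rightarrow> real"
  where "fun_scale c g = (\<lambda>x. c * g x)"

global_interpretation fun_vs: vector_space fun_scale
  by unfold_locales (simp_all add: fun_scale_def fun_eq_iff algebra_simps)

text \<open>
  An element of \<open>C[-b,b]\<close> is represented by its extension by zero to the whole real line.
  This makes \<open>C[-b,b]\<close> a subspace of the real vector space of all functions, and for its
  elements equality, linear independence and being nonzero mean the same as on \<open>[-b,b]\<close>.
\<close>

definition restrict_zero :: "real \<Rightarrow> (real \<Rightarrow> real) \<Rightarrow> real \<Rightarrow> real"
  where "restrict_zero b g = (\<lambda>x. if x \<in> {-b..b} then g x else 0)"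

definition cont_funs :: "real \<Rightarrow> (real \<Rightarrow> real) set"
  where "cont_funs b = {g. continuous_on {-b..b} g \<and> (\<forall>x. x \<notin> {-b..b} \<longrightarrow> g x = 0)}"

text \<open>
  Since \<open>dim\<close> is \<open>0\<close> for infinite-dimensional spaces, the equation for \<open>dim\<close> below does
  force \<open>V\<close> to be finite-dimensional.
\<close>

definition haar_condition :: "real \<Rightarrow> (real \<Rightarrow> real) set \<Rightarrow> bool"
  where "haar_condition b V \<longleftrightarrow>
    fun_vs.subspace V \<and> V \<subseteq> cont_funs b \<and>
    (\<exists>n. fun_vs.dim V = n + 1 \<and>
      (\<forall>v\<in>V. v \<noteq> 0 \<longrightarrow>
        finite {x \<in> {-b..b}. v x = 0} \<and> card {x \<in> {-b..b}. v x = 0} \<le> n))"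

definition tchebyshev_system :: "real \<Rightarrow> nat \<Rightarrow> (nat \<Rightarrow> real \<Rightarrow> real) \<Rightarrow> bool"
  where "tchebyshev_system b n h \<longleftrightarrow>
    inj_on h {0..n} \<and> fun_vs.independent (h ` {0..n}) \<and>
    haar_condition b (fun_vs.span (h ` {0..n}))"

definition markov_system :: "real \<Rightarrow> (nat \<Rightarrow> real \<Rightarrow> real) \<Rightarrow> bool"
  where "markov_system b h \<longleftrightarrow> (\<forall>n. tchebyshev_system b n h)"

text \<open>
  The recursive integrals; \<open>LBINT s=x0..x\<close> is the oriented integral, also for \<open>x < x0\<close>.
\<close>

primrec X_tilde :: "(real \<Rightarrow> real) \<Rightarrow> real \<Rightarrow> nat \<Rightarrow> real \<Rightarrow> real" where
  "X_tilde f x0 0 = (\<lambda>x. 1)"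
| "X_tilde f x0 (Suc m) = (\<lambda>x. real (Suc m) *
     (LBINT s=ereal x0..ereal x. X_tilde f x0 m s * ((f s)\<^sup>2 powi ((-1) ^ m))))"

primrec X_plain :: "(real \<Rightarrow> real) \<Rightarrow> real \<Rightarrow> nat \<Rightarrow> real \<Rightarrow> real" where
  "X_plain f x0 0 = (\<lambda>x. 1)"
| "X_plain f x0 (Suc m) = (\<lambda>x. real (Suc m) *
     (LBINT s=ereal x0..ereal x. X_plain f x0 m s * ((f s)\<^sup>2 powi ((-1) ^ Suc m))))"

definition phi :: "real \<Rightarrow> (real \<Rightarrow> real) \<Rightarrow> real \<Rightarrow> nat \<Rightarrow> real \<Rightarrow> real"
  where "phi b f x0 k = restrict_zero b
    (\<lambda>x. f x * (if odd k then X_plain f x0 k x else X_tilde f x0 k x))"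

end

theory Submission
  imports Defs
begin

text \<open>
  Write \<open>p = 1 / f\<^sup>2\<close> and \<open>q = f\<^sup>2\<close>. After division by \<open>f\<close>, the function \<open>\<phi>\<^sub>k\<close> is
  \<open>k!\<close> times the \<open>k\<close>-fold iterated integral from \<open>x0\<close> in which the weights \<open>p, q, p, \<dots>\<close>
  alternate, \<open>p\<close> being the outermost one (\<open>phi_eq_alt_integral\<close>). The parity switch between
  the two families in the definition of \<open>\<phi>\<^sub>k\<close> serves to make the outermost weight always \<open>p\<close>.

  Differentiating a combination of the first \<open>n + 2\<close> iterated integrals kills the constant term
  and pulls out the factor \<open>p\<close>, which has no zeros; what is left is a combination of the first
  \<open>n + 1\<close> iterated integrals with the roles of \<open>p\<close> and \<open>q\<close> exchanged. By Rolle's theorem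
  one integration creates at most one additional zero, so induction on \<open>n\<close>, with \<open>p\<close> and
  \<open>q\<close> arbitrary, shows that a nontrivial combination of the first \<open>n + 1\<close> of them has at most
  \<open>n\<close> zeros (\<open>alt_integral_zeros\<close>). The factor \<open>f\<close> has no zeros, so the same holds for
  \<open>\<phi>\<^sub>0, \<dots>, \<phi>\<^sub>n\<close>.

  A combination that is identically zero vanishes on the infinite set \<open>{-b..b}\<close>. Hence a bound
  on the zeros in terms of the coefficients already contains linear independence, and the Haar
  condition on the span follows (\<open>tchebyshev_systemI\<close>).
\<close>

section \<open>Counting zeros with Rolle's theorem\<close>

text \<open>
  The points are added in increasing order; the zero of the derivative that Rolle's theorem gives
  between the last two of them lies to the right of all those found before, which is what the
  bound \<open>T \<subseteq> {a<..<Max S}\<close> keeps track of.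
\<close>

lemma Rolle_zeros:
  fixes g g' :: "real \<Rightarrow> real"
  assumes "finite S" "S \<noteq> {}" "S \<subseteq> {a..b}" "\<forall>x\<in>S. g x = 0"
    and cont: "continuous_on {a..b} g"
    and deriv: "\<And>x. a < x \<Longrightarrow> x < b \<Longrightarrow> (g has_real_derivative g' x) (at x)"
  shows "\<exists>T. finite T \<and> T \<subseteq> {a<..<Max S} \<and> Suc (card T) = card S \<and> (\<forall>x\<in>T. g' x = 0)"
  using assms(1-4)
proof (induction S rule: finite_linorder_max_induct)
  case empty
  then show ?case by simp
next
  case (insert s A)
  show ?case
  proof (cases "A = {}")
    case True
    then show ?thesis by (intro exI[of _ "{}"]) simp
  next
    case False
    then obtain T where T: "finite T" "T \<subseteq> {a<..<Max A}" "Suc (card T) = card A"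
      "\<forall>x\<in>T. g' x = 0"
      using insert by auto
    define r where "r = Max A"
    have r: "r \<in> A" "r < s" "a \<le> r" "s \<le> b" "g r = 0" "g s = 0"
      using insert False unfolding r_def by (auto simp: subset_iff)
    have "\<exists>z>r. z < s \<and> (g has_real_derivative 0) (at z)"
    proof (rule Rolle)
      show "continuous_on {r..s} g"
        by (rule continuous_on_subset[OF cont]) (use r in auto)
      show "g differentiable (at x)" if "r < x" "x < s" for x
        using deriv[of x] that r real_differentiable_def by force
    qed (use r in auto)
    then obtain z where z: "r < z" "z < s" "(g has_real_derivative 0) (at z)"
      by blast
    have "g' z = 0"
      using DERIV_unique[OF z(3) deriv[of z]] z r by simp
    moreover have "z \<notin> T"
      using T(2) z(1) r_def by auto
    moreover have "Max (insert s A) = s"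
      using insert by (intro Max_eqI) auto
    moreover have "s \<notin> A"
      using insert by blast
    ultimately show ?thesis
      using T z r insert(1) r_def by (intro exI[of _ "insert z T"]) auto
  qed
qed

lemma card_zeros_le_Suc_deriv:
  fixes g g' :: "real \<Rightarrow> real"
  assumes cont: "continuous_on {a..b} g"
    and deriv: "\<And>x. a < x \<Longrightarrow> x < b \<Longrightarrow> (g has_real_derivative g' x) (at x)"
    and fin: "finite {x \<in> {a..b}. g' x = 0}" and card: "card {x \<in> {a..b}. g' x = 0} \<le> n"
  shows "finite {x \<in> {a..b}. g x = 0} \<and> card {x \<in> {a..b}. g x = 0} \<le> Suc n"
proof (rule finite_if_finite_subsets_card_bdd)
  fix S
  assume S: "S \<subseteq> {x \<in> {a..b}. g x = 0}" "finite S"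
  show "card S \<le> Suc n"
  proof (cases "S = {}")
    case False
    then obtain T where T: "T \<subseteq> {a<..<Max S}" "Suc (card T) = card S" "\<forall>x\<in>T. g' x = 0"
      using Rolle_zeros[OF S(2) False _ _ cont deriv] S(1) by blast
    have "Max S \<le> b"
      using S False Max_in[OF S(2) False] by auto
    then have "T \<subseteq> {x \<in> {a..b}. g' x = 0}"
      using T by force
    then have "card T \<le> n"
      using card_mono[OF fin] card by (meson le_trans)
    then show ?thesis
      using T by simp
  qed simp
qed

section \<open>Iterated integrals with alternating weights\<close>

text \<open>
  The weights are arguments of the values, not fixed parameters, since each integration exchanges
  them.
\<close>

primrec alt_integral ::
  "real \<Rightarrow> nat \<Rightarrow> (real \<Rightarrow> real) \<Rightarrow> (real \<Rightarrow> real) \<Rightarrow> real \<Rightarrow> real" where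
  "alt_integral x0 0 = (\<lambda>p q x. 1)"
| "alt_integral x0 (Suc m) = (\<lambda>p q x. real (Suc m) *
     (LBINT s=ereal x0..ereal x. alt_integral x0 m q p s * p s))"

lemma alt_integral_continuous_deriv:
  assumes "x0 \<in> {a..b}" "continuous_on {a..b} p" "continuous_on {a..b} q"
  shows "continuous_on {a..b} (alt_integral x0 m p q)"
    and "x \<in> {a..b} \<Longrightarrow> (alt_integral x0 (Suc m) p q has_real_derivative
           real (Suc m) * (alt_integral x0 m q p x * p x)) (at x within {a..b})"
proof -
  have cont_deriv: "((alt_integral x0 (Suc m) p q) has_real_derivative
      real (Suc m) * (alt_integral x0 m q p x * p x)) (at x within {a..b})"
    if "x0 \<in> {a..b}" "continuous_on {a..b} p" "continuous_on {a..b} (alt_integral x0 m q p)"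
      "x \<in> {a..b}" for m p q x
    unfolding alt_integral.simps
    by (intro DERIV_cmult)
      (use that in \<open>auto simp: has_real_derivative_iff_has_vector_derivative
         intro!: interval_integral_FTC2 continuous_intros\<close>)
  have cont: "continuous_on {a..b} (alt_integral x0 m p q)"
    if "continuous_on {a..b} p" "continuous_on {a..b} q" for m p q
    using that
  proof (induction m arbitrary: p q)
    case (Suc m)
    show ?case
      by (rule DERIV_continuous_on[OF cont_deriv]) (use Suc assms(1) in auto)
  qed simp
  show "continuous_on {a..b} (alt_integral x0 m p q)"
    using assms by (intro cont)
  show "(alt_integral x0 (Suc m) p q has_real_derivative
           real (Suc m) * (alt_integral x0 m q p x * p x)) (at x within {a..b})"
    if "x \<in> {a..b}"
    using assms that by (intro cont_deriv cont)
qed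

text \<open>
  The exchanged weights in the derivative are the reason why the induction needs the claim for all
  pairs of weights. The factor \<open>k\<close> produced by the normalization \<open>k!\<close> only rescales the
  coefficients.
\<close>

lemma alt_integral_zeros:
  assumes "x0 \<in> {a..b}" "continuous_on {a..b} p" "continuous_on {a..b} q"
    and "\<forall>x\<in>{a..b}. p x \<noteq> 0" "\<forall>x\<in>{a..b}. q x \<noteq> 0"
    and "\<exists>k\<le>n. c k \<noteq> 0"
  shows "finite {x \<in> {a..b}. (\<Sum>k\<le>n. c k * alt_integral x0 k p q x) = 0} \<and>
         card {x \<in> {a..b}. (\<Sum>k\<le>n. c k * alt_integral x0 k p q x) = 0} \<le> n"
  using assms(2-)
proof (induction n arbitrary: p q c)
  case 0
  then show ?case by simp
next
  case (Suc n)
  let ?g = "\<lambda>x. \<Sum>k\<le>Suc n. c k * alt_integral x0 k p q x"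
  have g_shift: "?g x = c 0 + (\<Sum>k\<le>n. c (Suc k) * alt_integral x0 (Suc k) p q x)" for x
    by (subst sum.atMost_Suc_shift) simp
  show ?case
  proof (cases "\<exists>k\<le>n. c (Suc k) \<noteq> 0")
    case False
    \<comment> \<open>the combination is the nonzero constant \<open>c 0\<close>\<close>
    then have "c 0 \<noteq> 0"
      using Suc.prems(5) by (metis Suc_le_mono not0_implies_Suc)
    moreover have "?g x = c 0" for x
      unfolding g_shift using False by simp
    ultimately show ?thesis by simp
  next
    case True
    define d where "d k = real (Suc k) * c (Suc k)" for k
    define h where "h x = (\<Sum>k\<le>n. d k * alt_integral x0 k q p x)" for x
    have "\<exists>k\<le>n. d k \<noteq> 0"
      using True by (auto simp: d_def)
    then have h: "finite {x \<in> {a..b}. h x = 0} \<and> card {x \<in> {a..b}. h x = 0} \<le> n"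
      unfolding h_def using Suc.prems by (intro Suc.IH) auto
    have eq: "{x \<in> {a..b}. p x * h x = 0} = {x \<in> {a..b}. h x = 0}"
      using Suc.prems by auto
    show ?thesis
    proof (rule card_zeros_le_Suc_deriv[where g' = "\<lambda>x. p x * h x"])
      show "continuous_on {a..b} ?g"
        using Suc.prems assms(1)
        by (intro continuous_intros alt_integral_continuous_deriv(1)) auto
      show "(?g has_real_derivative p x * h x) (at x)" if x: "a < x" "x < b" for x
      proof -
        have "(?g has_real_derivative
            0 + (\<Sum>k\<le>n. c (Suc k) * (real (Suc k) * (alt_integral x0 k q p x * p x))))
            (at x within {a..b})"
          unfolding g_shift
          using Suc.prems assms(1) x
          by (intro DERIV_add DERIV_const DERIV_sum DERIV_cmult
              alt_integral_continuous_deriv(2)) auto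
        also have "0 + (\<Sum>k\<le>n. c (Suc k) * (real (Suc k) * (alt_integral x0 k q p x * p x)))
            = p x * h x"
          by (simp add: h_def d_def sum_distrib_left mult_ac)
        finally show ?thesis
          using at_within_Icc_at[OF x] by simp
      qed
    qed (use h eq in auto)
  qed
qed

lemma X_tilde_X_plain_eq_alt_integral:
  fixes f :: "real \<Rightarrow> real"
  defines "p \<equiv> \<lambda>s. inverse ((f s)\<^sup>2)" and "q \<equiv> \<lambda>s. (f s)\<^sup>2"
  shows "X_tilde f x0 k = (if even k then alt_integral x0 k p q else alt_integral x0 k q p)"
    and "X_plain f x0 k = (if odd k then alt_integral x0 k p q else alt_integral x0 k q p)"
proof -
  have weight: "(f s)\<^sup>2 powi ((-1) ^ m) = (if even m then q s else p s)" for s and m :: nat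
    unfolding p_def q_def by (cases "even m") simp_all
  show "X_tilde f x0 k = (if even k then alt_integral x0 k p q else alt_integral x0 k q p)"
  proof (induction k)
    case (Suc k)
    then show ?case
      by (cases "even k") (simp_all only: X_tilde.simps weight, simp_all)
  qed simp
  show "X_plain f x0 k = (if odd k then alt_integral x0 k p q else alt_integral x0 k q p)"
  proof (induction k)
    case (Suc k)
    then show ?case
      by (cases "even k") (simp_all only: X_plain.simps weight, simp_all)
  qed simp
qed

lemma phi_eq_alt_integral:
  "phi b f x0 k = restrict_zero b
     (\<lambda>x. f x * alt_integral x0 k (\<lambda>s. inverse ((f s)\<^sup>2)) (\<lambda>s. (f s)\<^sup>2) x)"
  unfolding phi_def by (cases "even k") (simp_all add: X_tilde_X_plain_eq_alt_integral)

section \<open>From bounds on zeros to Tchebyshev systems\<close>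

lemma sum_fun_scale_apply:
  "(\<Sum>i\<in>A. fun_scale (c i) (h i)) x = (\<Sum>i\<in>A. c i * h i x)"
  by (induction A rule: infinite_finite_induct) (auto simp: fun_scale_def)

text \<open>
  The hypothesis on the coefficients yields independence because \<open>{-b..b}\<close> is infinite, so that
  no combination with finitely many zeros is the zero function. This also gives the injectivity of
  \<open>h\<close>, through the combination \<open>h i - h j\<close>.
\<close>

lemma tchebyshev_systemI:
  assumes "b > 0"
    and cont: "\<And>k. k \<le> n \<Longrightarrow> h k \<in> cont_funs b"
    and zeros: "\<And>c. \<exists>k\<le>n. c k \<noteq> 0 \<Longrightarrow>
      finite {x \<in> {-b..b}. (\<Sum>k\<le>n. c k * h k x) = 0} \<and>
      card {x \<in> {-b..b}. (\<Sum>k\<le>n. c k * h k x) = 0} \<le> n"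
  shows "tchebyshev_system b n h"
proof -
  have coeffs_zero: "c k = 0"
    if "\<And>x. (\<Sum>k\<le>n. c k * h k x) = 0" "k \<le> n" for c k
  proof (rule ccontr)
    assume "c k \<noteq> 0"
    then have "finite {x \<in> {-b..b}. (\<Sum>k\<le>n. c k * h k x) = 0}"
      using zeros[of c] that(2) by blast
    moreover have "{x \<in> {-b..b}. (\<Sum>k\<le>n. c k * h k x) = 0} = {-b..b}"
      using that(1) by blast
    ultimately have "finite {-b..b}"
      by simp
    then show False
      using infinite_Icc[of "-b" b] \<open>b > 0\<close> by simp
  qed
  have inj: "inj_on h {0..n}"
  proof (rule inj_onI, rule ccontr)
    fix i j
    assume ij: "i \<in> {0..n}" "j \<in> {0..n}" "h i = h j" "i \<noteq> j"
    define c :: "nat \<Rightarrow> real" where "c k = (if k = i then 1 else 0) - (if k = j then 1 else 0)" for k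
    have "(\<Sum>k\<le>n. c k * h k x) = 0" for x
      using ij by (simp add: c_def left_diff_distrib sum_subtractf if_distrib[of "\<lambda>u. u * _"]
          cong: if_cong)
    then have "c i = 0"
      using coeffs_zero[of c i] ij by simp
    then show False
      using ij by (simp add: c_def)
  qed
  have comb: "(\<Sum>v\<in>h ` {0..n}. fun_scale (u v) v) x = (\<Sum>k\<le>n. u (h k) * h k x)" for u x
    by (subst sum.reindex[OF inj]) (simp add: sum_fun_scale_apply o_def atMost_atLeast0)
  have indep: "fun_vs.independent (h ` {0..n})"
  proof (rule fun_vs.independent_if_scalars_zero)
    fix u v
    assume "(\<Sum>v\<in>h ` {0..n}. fun_scale (u v) v) = 0" and v: "v \<in> h ` {0..n}"
    then have "(\<Sum>k\<le>n. u (h k) * h k x) = 0" for x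
      using comb[of u x] by simp
    then show "u v = 0"
      using coeffs_zero[of "\<lambda>k. u (h k)"] v by auto
  qed simp
  have span: "\<exists>c. v = (\<lambda>x. \<Sum>k\<le>n. c k * h k x)" if "v \<in> fun_vs.span (h ` {0..n})" for v
  proof -
    have "v \<in> range (\<lambda>u. \<Sum>w\<in>h ` {0..n}. fun_scale (u w) w)"
      using that by (subst (asm) fun_vs.span_finite) simp_all
    then obtain u where "v = (\<Sum>w\<in>h ` {0..n}. fun_scale (u w) w)"
      by (rule rangeE)
    then have "v = (\<lambda>x. \<Sum>k\<le>n. u (h k) * h k x)"
      using comb by (simp add: fun_eq_iff)
    then show ?thesis
      by (intro exI[of _ "\<lambda>k. u (h k)"])
  qed
  have "haar_condition b (fun_vs.span (h ` {0..n}))"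
    unfolding haar_condition_def
  proof (intro conjI exI[of _ n] ballI impI)
    show "fun_vs.subspace (fun_vs.span (h ` {0..n}))"
      by (rule fun_vs.subspace_span)
    show "fun_vs.span (h ` {0..n}) \<subseteq> cont_funs b"
    proof
      fix v
      assume "v \<in> fun_vs.span (h ` {0..n})"
      then obtain c where v: "v = (\<lambda>x. \<Sum>k\<le>n. c k * h k x)"
        using span by blast
      show "v \<in> cont_funs b"
        using cont unfolding v cont_funs_def by (auto intro!: continuous_intros sum.neutral)
    qed
    show "fun_vs.dim (fun_vs.span (h ` {0..n})) = n + 1"
      using fun_vs.dim_span_eq_card_independent[OF indep] card_image[OF inj] by simp
  next
    fix v
    assume "v \<in> fun_vs.span (h ` {0..n})" "v \<noteq> 0"
    then obtain c where v: "v = (\<lambda>x. \<Sum>k\<le>n. c k * h k x)"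
      using span by blast
    have "\<exists>k\<le>n. c k \<noteq> 0"
    proof (rule ccontr)
      assume "\<not> (\<exists>k\<le>n. c k \<noteq> 0)"
      then show False
        using \<open>v \<noteq> 0\<close> unfolding v by (simp add: fun_eq_iff)
    qed
    from zeros[OF this] show "finite {x \<in> {-b..b}. v x = 0}"
      and "card {x \<in> {-b..b}. v x = 0} \<le> n"
      unfolding v by auto
  qed
  then show ?thesis
    using inj indep by (simp add: tchebyshev_system_def)
qed

theorem proposition32:
  fixes b x0 :: real and f :: "real \<Rightarrow> real"
  assumes "b > 0"
    and "x0 \<in> {-b..b}"
    and "continuous_on {-b..b} f"
    and "\<forall>x\<in>{-b..b}. f x \<noteq> 0"
  shows "markov_system b (phi b f x0) \<and>
    (\<forall>n. tchebyshev_system b n (phi b f x0) \<and>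
         haar_condition b (fun_vs.span (phi b f x0 ` {0..n})))"
proof -
  define p q where "p = (\<lambda>s. inverse ((f s)\<^sup>2))" and "q = (\<lambda>s. (f s)\<^sup>2)"
  have pq: "continuous_on {-b..b} p" "continuous_on {-b..b} q"
    "\<forall>x\<in>{-b..b}. p x \<noteq> 0" "\<forall>x\<in>{-b..b}. q x \<noteq> 0"
    unfolding p_def q_def using assms by (auto intro!: continuous_intros)
  have phi: "phi b f x0 k = restrict_zero b (\<lambda>x. f x * alt_integral x0 k p q x)" for k
    by (simp add: phi_eq_alt_integral p_def q_def)
  have "tchebyshev_system b n (phi b f x0)" for n
  proof (rule tchebyshev_systemI[OF \<open>b > 0\<close>])
    fix k
    have "continuous_on {-b..b} (\<lambda>x. f x * alt_integral x0 k p q x)"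
      using assms pq by (intro continuous_intros alt_integral_continuous_deriv(1))
    then have "continuous_on {-b..b} (phi b f x0 k)"
      by (rule continuous_on_eq) (simp add: phi restrict_zero_def)
    then show "phi b f x0 k \<in> cont_funs b"
      by (auto simp: cont_funs_def phi restrict_zero_def)
  next
    fix c :: "nat \<Rightarrow> real"
    assume c: "\<exists>k\<le>n. c k \<noteq> 0"
    have "(\<Sum>k\<le>n. c k * phi b f x0 k x) = f x * (\<Sum>k\<le>n. c k * alt_integral x0 k p q x)"
      if "x \<in> {-b..b}" for x
      using that by (simp add: phi restrict_zero_def sum_distrib_left mult_ac)
    then have "{x \<in> {-b..b}. (\<Sum>k\<le>n. c k * phi b f x0 k x) = 0} =
        {x \<in> {-b..b}. (\<Sum>k\<le>n. c k * alt_integral x0 k p q x) = 0}"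
      using assms(4) by auto
    then show "finite {x \<in> {-b..b}. (\<Sum>k\<le>n. c k * phi b f x0 k x) = 0} \<and>
        card {x \<in> {-b..b}. (\<Sum>k\<le>n. c k * phi b f x0 k x) = 0} \<le> n"
      using alt_integral_zeros[OF assms(2) pq c] by simp
  qed
  then show ?thesis
    by (auto simp: markov_system_def tchebyshev_system_def)
qed

end
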